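(* Fix $a,b,c,d\in\mathbb{R}$ with $a<b\le c<d$ and $n\in\mathbb{N}=\{1,2,\dots\}$. Then for all $X,Y\in\mathcal{X}_{[a,b]}$, $$X\ge_n^{[a,c]}Y\ \Longrightarrow\ X\ge_n^{[a,d]}Y.$$ Moreover, the backward implication (namely, that for all $X,Y\in\mathcal{X}_{[a,b]}$, $X\ge_n^{[a,d]}Y$ implies $X\ge_n^{[a,c]}Y$) holds if and only if $n\le 3$.
   Context: For real $s<t$, $\mathcal{X}_{[s,t]}$ denotes the set of all bounded random variables taking values in $[s,t]$. All relations below depend only on the distributions, and every distribution supported in $[s,t]$ is the distribution of some element of $\mathcal{X}_{[s,t]}$. $F_X$ is the distribution function of $X$. Write $[n]=\{1,\dots,n\}$. For a distribution function $F$, put $F^{[1]}=F$ and $F^{[k]}(\eta)=\int_{-\infty}^{\eta}F^{[k-1]}(\xi)\,\mathrm{d}\xi$ for $\eta\in\mathbb{R}$, $k\ge 2$. (Thus $F_X^{[k+1]}(\eta)=\frac{1}{k!}\mathbb{E}[(\eta-X)_+^{k}]$ for $k\ge1$, where $x_+=\max\{0,x\}$.) $n$th-order stochastic dominance on $[s,t]$: for $X,Y\in\mathcal{X}_{[s,t]}$, $X\ge_n^{[s,t]}Y$ means $F_X^{[n]}(\eta)\le F_Y^{[n]}(\eta)$ for all $\eta\in[s,t]$ and $F_X^{[k]}(t)\le F_Y^{[k]}(t)$ for all $k\in[n]$. *)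

theory Defs
  imports "HOL-Probability.Probability"
begin

definition rvs :: "'w measure \<Rightarrow> real \<Rightarrow> real \<Rightarrow> ('w \<Rightarrow> real) set" where
  "rvs M s t = {X \<in> borel_measurable M. \<forall>\<omega>\<in>space M. s \<le> X \<omega> \<and> X \<omega> \<le> t}"

text \<open>
  The random variables live on a fixed probability space that supports every distribution
  concentrated on a compact interval.
\<close>

locale rich_prob_space = prob_space M for M :: "'w measure" +
  assumes rich:
    "\<And>s t N. s < t \<Longrightarrow> real_distribution N \<Longrightarrow> measure N {s..t} = 1 \<Longrightarrow>
       \<exists>X\<in>rvs M s t. distr M borel X = N"

definition dist_fun :: "'w measure \<Rightarrow> ('w \<Rightarrow> real) \<Rightarrow> real \<Rightarrow> real" where
  "dist_fun M X = cdf (distr M borel X)"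

text \<open>The order is 1-based, with index 1 giving \<open>F\<close> itself; the value at index 0 is a dummy.\<close>

fun iter_df :: "(real \<Rightarrow> real) \<Rightarrow> nat \<Rightarrow> real \<Rightarrow> real" where
  "iter_df F 0 = (\<lambda>_. 0)"
| "iter_df F (Suc 0) = F"
| "iter_df F (Suc (Suc k)) = (\<lambda>\<eta>. LBINT \<xi>:{..\<eta>}. iter_df F (Suc k) \<xi>)"

text \<open>Only meant for \<open>X, Y \<in> rvs M s t\<close> and \<open>n \<ge> 1\<close>.\<close>

definition sd_on ::
    "'w measure \<Rightarrow> nat \<Rightarrow> real \<Rightarrow> real \<Rightarrow> ('w \<Rightarrow> real) \<Rightarrow> ('w \<Rightarrow> real) \<Rightarrow> bool" where
  "sd_on M n s t X Y \<longleftrightarrow>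
     (\<forall>\<eta>\<in>{s..t}. iter_df (dist_fun M X) n \<eta> \<le> iter_df (dist_fun M Y) n \<eta>) \<and>
     (\<forall>k\<in>{1..n}. iter_df (dist_fun M X) k t \<le> iter_df (dist_fun M Y) k t)"

text \<open>Rich probability spaces exist: the uniform distribution on the unit interval is one.\<close>

lemma rich_prob_space_uniform:
  "rich_prob_space (restrict_space lborel {0<..<1::real})" (is "rich_prob_space ?\<Omega>")
proof -
  interpret \<Omega>: prob_space ?\<Omega>
    by (auto simp add: emeasure_restrict_space space_restrict_space intro!: prob_spaceI)
  show ?thesis
  proof
    fix s t :: real and N :: "real measure"
    assume st: "s < t" and N: "real_distribution N" and one: "measure N {s..t} = 1"
    interpret N: cdf_distribution N
      using N by (simp add: cdf_distribution_def)
    define g where "g = (\<lambda>x::real. max s (min t x))"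
    define I where "I = (\<lambda>\<omega>. Inf {x. \<omega> \<le> cdf N x})"
    have g[measurable]: "g \<in> borel_measurable borel"
      unfolding g_def by measurable
    have "I \<in> borel_measurable (restrict_space borel {0<..<1})"
      unfolding I_def by (rule N.measurable_CI)
    then have I[measurable]: "I \<in> borel_measurable ?\<Omega>"
      by (subst measurable_cong_sets[where M'="restrict_space borel {0<..<1}" and N'=borel])
         (auto intro!: sets_restrict_space_cong)
    have "distr ?\<Omega> borel (g \<circ> I) = distr (distr ?\<Omega> borel I) borel g"
      by (subst distr_distr) auto
    also have "distr ?\<Omega> borel I = N"
      unfolding I_def by (rule N.distr_I_eq_M)
    also have "distr N borel g = N"
    proof -
      have ae: "AE x in N. x \<in> {s..t}"
        using one by (intro N.AE_prob_1)
      have "distr N borel g = distr N borel (\<lambda>x. x)"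
        by (rule distr_cong_AE) (use ae in \<open>auto simp: g_def\<close>)
      also have "\<dots> = N"
        by (rule distr_id2) simp
      finally show ?thesis .
    qed
    finally have "distr ?\<Omega> borel (g \<circ> I) = N" .
    moreover have "g \<circ> I \<in> rvs ?\<Omega> s t"
      using st by (auto simp: rvs_def g_def)
    ultimately show "\<exists>X\<in>rvs ?\<Omega> s t. distr ?\<Omega> borel X = N"
      by blast
  qed
qed

end

theory Submission
  imports Defs
begin

text \<open>
  Write \<open>D\<^sub>k = F\<^sub>X\<^bsup>[k]\<^esup> - F\<^sub>Y\<^bsup>[k]\<^esup>\<close>, so that \<open>D\<^sub>k\<^sub>+\<^sub>1\<close> is the integral of \<open>D\<^sub>k\<close>, and
  \<open>D\<^sub>1 = 0\<close> on \<open>[b, \<infinity>)\<close> because both distributions live on \<open>[a, b]\<close>.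

  If \<open>D\<^sub>k(c) \<le> 0\<close> for all \<open>k \<le> n\<close>, then integrating from \<open>c\<close> gives
  \<open>D\<^sub>k \<le> 0\<close> on \<open>[c, d]\<close> by induction on \<open>k\<close>; hence dominance on \<open>[a, c]\<close> extends to
  \<open>[a, d]\<close> (\<open>sd_on_extend\<close>).

  Conversely, the condition on \<open>D\<^sub>n\<close> over \<open>[a, d]\<close> includes \<open>D\<^sub>n(c) \<le> 0\<close>, while
  \<open>D\<^sub>1(c) = 0\<close> and \<open>D\<^sub>2(c) = D\<^sub>2(d)\<close>, as \<open>D\<^sub>2\<close> is constant past \<open>b\<close>. For \<open>n \<le> 3\<close> this
  covers every end point condition at \<open>c\<close> (\<open>sd_on_shrink\<close>).

  For \<open>n \<ge> 4\<close> the condition \<open>D\<^sub>3(c) \<le> 0\<close> is lost: past \<open>b\<close> the function \<open>D\<^sub>3\<close> is affine with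
  slope \<open>D\<^sub>2(b)\<close>, and it may change sign from positive to negative between \<open>c\<close> and \<open>d\<close>. The
  counterexample (\<open>ex_sd_on_not_shrink\<close>) uses the points \<open>a, a + h, a + 2h, b\<close> with
  \<open>h = (b - a) / 3\<close>. The law of \<open>X\<close> minus the law of \<open>Y\<close> is, up to normalisation, the third
  difference \<open>(-1, 3, -3, 1)\<close> plus a small multiple of a perturbation \<open>(0, +, -, +)\<close>. The third
  difference has vanishing moments up to order two, so it does not affect \<open>D\<^sub>1, D\<^sub>2, D\<^sub>3\<close> past
  \<open>b\<close>, and it makes \<open>D\<^sub>4\<close> nonpositive everywhere and bounded away from zero past \<open>a + h\<close>. The
  perturbation is chosen so that \<open>D\<^sub>2(b) < 0\<close> and \<open>D\<^sub>3\<close> vanishes at the midpoint of \<open>[c, d]\<close>;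
  being supported in \<open>[a + h, b]\<close> and small, it keeps \<open>D\<^sub>4 \<le> 0\<close> on \<open>(-\<infinity>, d]\<close>. Integration
  then gives \<open>D\<^sub>k \<le> 0\<close> on \<open>(-\<infinity>, d]\<close> for all \<open>k \<ge> 4\<close>. The positive and the negative
  part of the total have two atoms each: \<open>X\<close> lives on \<open>{a + h, b}\<close> and \<open>Y\<close> on \<open>{a, a + 2h}\<close>.
\<close>

section \<open>Iterated integrals of distribution functions\<close>

text \<open>
  The properties of a distribution function supported in \<open>[a, \<infinity>)\<close> that survive integration:
  monotone, and zero to the left of \<open>a\<close>. They ensure that all the iterated integrals over
  \<open>(-\<infinity>, \<eta>]\<close> converge.
\<close>

definition mono_from :: "real \<Rightarrow> (real \<Rightarrow> real) \<Rightarrow> bool" where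
  "mono_from a F \<longleftrightarrow> mono F \<and> (\<forall>x<a. F x = 0)"

lemma mono_from_nonneg:
  assumes "mono_from a F"
  shows "0 \<le> F x"
proof -
  have "F (min x (a - 1)) \<le> F x"
    using assms by (intro monoD[of F]) (auto simp: mono_from_def)
  moreover have "F (min x (a - 1)) = 0"
    using assms by (auto simp: mono_from_def)
  ultimately show ?thesis by simp
qed

lemma mono_from_set_integrable:
  assumes F: "mono_from a F" and S: "S \<in> sets borel" "S \<subseteq> {..\<eta>}"
  shows "set_integrable lborel S F"
proof -
  have mono: "mono F" and zero: "\<And>x. x < a \<Longrightarrow> F x = 0"
    using F by (auto simp: mono_from_def)
  have [measurable]: "F \<in> borel_measurable borel"
    using mono by (rule borel_measurable_mono)
  have "set_integrable lborel {a..\<eta>} F"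
  proof (rule set_integrable_bound[where f="\<lambda>_. F \<eta>"])
    show "set_integrable lborel {a..\<eta>} (\<lambda>_. F \<eta>)"
      by (rule borel_integrable_atLeastAtMost') (rule continuous_on_const)
    show "set_borel_measurable lborel {a..\<eta>} F"
      unfolding set_borel_measurable_def by measurable
    show "AE x in lborel. x \<in> {a..\<eta>} \<longrightarrow> norm (F x) \<le> norm (F \<eta>)"
      using mono_from_nonneg[OF F] mono by (auto simp: monoD)
  qed
  then have "integrable lborel (\<lambda>x. indicator {a..\<eta>} x *\<^sub>R F x)"
    by (simp add: set_integrable_def)
  also have "(\<lambda>x. indicator {a..\<eta>} x *\<^sub>R F x) = (\<lambda>x. indicator {..\<eta>} x *\<^sub>R F x)"
    using zero by (force simp: indicator_def)
  finally have "set_integrable lborel {..\<eta>} F"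
    by (simp add: set_integrable_def)
  then show ?thesis
    using S by (auto intro: set_integrable_subset)
qed

lemma mono_from_integral_split:
  assumes F: "mono_from a F" and "c \<le> d"
  shows "(LBINT \<xi>:{..d}. F \<xi>) = (LBINT \<xi>:{..c}. F \<xi>) + (LBINT \<xi>:{c<..d}. F \<xi>)"
proof -
  have "{..d} = {..c} \<union> {c<..d}"
    using \<open>c \<le> d\<close> by auto
  moreover have "set_integrable lborel {..c} F" "set_integrable lborel {c<..d} F"
    by (rule mono_from_set_integrable[OF F, of _ "max c d"]; auto)+
  moreover have "{..c} \<inter> {c<..d} = {}"
    by auto
  ultimately show ?thesis
    by (simp add: set_integral_Un)
qed

lemma mono_from_integral:
  assumes F: "mono_from a F"
  shows "mono_from a (\<lambda>\<eta>. LBINT \<xi>:{..\<eta>}. F \<xi>)"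
  unfolding mono_from_def
proof (intro conjI monoI allI impI)
  fix c d :: real
  assume "c \<le> d"
  moreover have "0 \<le> (LBINT \<xi>:{c<..d}. F \<xi>)"
    unfolding set_lebesgue_integral_def
    by (intro integral_nonneg_AE) (simp add: mono_from_nonneg[OF F])
  ultimately show "(LBINT \<xi>:{..c}. F \<xi>) \<le> (LBINT \<xi>:{..d}. F \<xi>)"
    using mono_from_integral_split[OF F] by simp
next
  fix \<eta> :: real
  assume "\<eta> < a"
  then have "(\<lambda>x. indicator {..\<eta>} x *\<^sub>R F x) = (\<lambda>_. 0)"
    using F by (force simp: mono_from_def indicator_def)
  then show "(LBINT \<xi>:{..\<eta>}. F \<xi>) = 0"
    by (simp add: set_lebesgue_integral_def)
qed

lemma iter_df_Suc:
  assumes "1 \<le> k"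
  shows "iter_df F (Suc k) = (\<lambda>\<eta>. LBINT \<xi>:{..\<eta>}. iter_df F k \<xi>)"
  using assms by (cases k) auto

lemma mono_from_iter_df:
  assumes "mono_from a F" and "1 \<le> k"
  shows "mono_from a (iter_df F k)"
  using \<open>1 \<le> k\<close>
proof (induction k rule: dec_induct)
  case base
  then show ?case using assms by simp
next
  case (step k)
  then show ?case by (simp add: iter_df_Suc mono_from_integral)
qed

lemma iter_df_increment_le:
  assumes F: "mono_from a F" and G: "mono_from a G" and "1 \<le> k" and "c \<le> d"
    and le: "\<And>x. c < x \<Longrightarrow> x \<le> d \<Longrightarrow> iter_df F k x \<le> iter_df G k x"
  shows "iter_df F (Suc k) d - iter_df F (Suc k) c
           \<le> iter_df G (Suc k) d - iter_df G (Suc k) c"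
proof -
  have F': "mono_from a (iter_df F k)" and G': "mono_from a (iter_df G k)"
    using F G \<open>1 \<le> k\<close> by (auto intro: mono_from_iter_df)
  have "set_integrable lborel {c<..d} (iter_df F k)" "set_integrable lborel {c<..d} (iter_df G k)"
    by (rule mono_from_set_integrable[OF F', of _ d] mono_from_set_integrable[OF G', of _ d]; auto)+
  then have "(LBINT \<xi>:{c<..d}. iter_df F k \<xi>) \<le> (LBINT \<xi>:{c<..d}. iter_df G k \<xi>)"
    using le by (intro set_integral_mono) auto
  then show ?thesis
    using mono_from_integral_split[OF F' \<open>c \<le> d\<close>] mono_from_integral_split[OF G' \<open>c \<le> d\<close>]
    by (simp add: iter_df_Suc[OF \<open>1 \<le> k\<close>])
qed

text \<open>
  Once the inequality holds at order \<open>m\<close> on a whole left half-line, it passes to every higher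
  order.
\<close>

lemma iter_df_mono_below:
  assumes F: "mono_from a F" and G: "mono_from a G" and "1 \<le> m" and "m \<le> k"
    and le: "\<And>x. x \<le> d \<Longrightarrow> iter_df F m x \<le> iter_df G m x"
    and "x \<le> d"
  shows "iter_df F k x \<le> iter_df G k x"
  using \<open>m \<le> k\<close> \<open>x \<le> d\<close>
proof (induction k arbitrary: x rule: dec_induct)
  case base
  then show ?case by (rule le)
next
  case (step k)
  have "1 \<le> k" using \<open>1 \<le> m\<close> step.hyps by simp
  \<comment> \<open>The integration starts at a point where both functions still vanish.\<close>
  define y where "y = min x (a - 1)"
  have "y \<le> x" "y < a" by (auto simp: y_def)
  have "iter_df F (Suc k) y = 0" "iter_df G (Suc k) y = 0"
    using mono_from_iter_df[OF F, of "Suc k"] mono_from_iter_df[OF G, of "Suc k"] \<open>y < a\<close>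
    by (auto simp: mono_from_def)
  moreover have "iter_df F (Suc k) x - iter_df F (Suc k) y
      \<le> iter_df G (Suc k) x - iter_df G (Suc k) y"
    using step.IH step.prems by (intro iter_df_increment_le[OF F G \<open>1 \<le> k\<close> \<open>y \<le> x\<close>]) auto
  ultimately show ?case by simp
qed

lemma
  assumes "prob_space M" and X: "X \<in> rvs M a b"
  shows mono_from_dist_fun: "mono_from a (dist_fun M X)"
    and dist_fun_eq_1: "b \<le> x \<Longrightarrow> dist_fun M X x = 1"
proof -
  interpret prob_space M by fact
  have [measurable]: "X \<in> borel_measurable M"
    and bounds: "\<And>\<omega>. \<omega> \<in> space M \<Longrightarrow> a \<le> X \<omega> \<and> X \<omega> \<le> b"
    using X by (auto simp: rvs_def)
  interpret D: real_distribution "distr M borel X"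
    by (rule real_distribution_distr) measurable
  have eq: "dist_fun M X x = prob {\<omega> \<in> space M. X \<omega> \<le> x}" for x
    by (simp add: dist_fun_def cdf_def measure_distr vimage_def Int_def conj_commute)
  have "dist_fun M X x = 0" if "x < a" for x
  proof -
    have "{\<omega> \<in> space M. X \<omega> \<le> x} = {}"
      using bounds that by force
    then show ?thesis by (simp only: eq measure_empty)
  qed
  moreover have "mono (dist_fun M X)"
    by (auto intro!: monoI D.cdf_nondecreasing simp: dist_fun_def)
  ultimately show "mono_from a (dist_fun M X)"
    by (simp add: mono_from_def)
  show "dist_fun M X x = 1" if "b \<le> x"
  proof -
    have "{\<omega> \<in> space M. X \<omega> \<le> x} = space M"
      using bounds that by force
    then show ?thesis by (simp only: eq prob_space)
  qed
qed

section \<open>Changing the right end point\<close>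

lemma sd_on_extend:
  assumes M: "prob_space M" and X: "X \<in> rvs M a b" and Y: "Y \<in> rvs M a b"
    and "b \<le> c" and "c \<le> d" and "1 \<le> n"
    and sd: "sd_on M n a c X Y"
  shows "sd_on M n a d X Y"
proof -
  let ?F = "dist_fun M X" and ?G = "dist_fun M Y"
  note F = mono_from_dist_fun[OF M X] and G = mono_from_dist_fun[OF M Y]
  have beyond: "k \<le> n \<longrightarrow> (\<forall>\<eta>\<in>{c..d}. iter_df ?F k \<eta> \<le> iter_df ?G k \<eta>)" if "1 \<le> k" for k
    using that
  proof (induction k rule: dec_induct)
    case base
    then show ?case
      using dist_fun_eq_1[OF M X] dist_fun_eq_1[OF M Y] \<open>b \<le> c\<close> by simp
  next
    case (step k)
    show ?case
    proof (intro impI ballI)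
      fix \<eta>
      assume "Suc k \<le> n" and \<eta>: "\<eta> \<in> {c..d}"
      then have "iter_df ?F (Suc k) c \<le> iter_df ?G (Suc k) c"
        using sd by (auto simp: sd_on_def simp del: iter_df.simps)
      moreover have "iter_df ?F (Suc k) \<eta> - iter_df ?F (Suc k) c
          \<le> iter_df ?G (Suc k) \<eta> - iter_df ?G (Suc k) c"
        using step \<open>Suc k \<le> n\<close> \<eta>
        by (intro iter_df_increment_le[OF F G]) auto
      ultimately show "iter_df ?F (Suc k) \<eta> \<le> iter_df ?G (Suc k) \<eta>"
        by linarith
    qed
  qed
  have "iter_df ?F n \<eta> \<le> iter_df ?G n \<eta>" if "\<eta> \<in> {a..d}" for \<eta>
    using that sd beyond[of n] \<open>1 \<le> n\<close>
    by (cases "\<eta> \<le> c") (auto simp: sd_on_def)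
  then show ?thesis
    using beyond \<open>c \<le> d\<close> by (auto simp: sd_on_def)
qed

lemma iter_df_2_diff_constant:
  assumes M: "prob_space M" and X: "X \<in> rvs M a b" and Y: "Y \<in> rvs M a b"
    and "b \<le> c" and "c \<le> d"
  shows "iter_df (dist_fun M X) 2 d - iter_df (dist_fun M Y) 2 d
           = iter_df (dist_fun M X) 2 c - iter_df (dist_fun M Y) 2 c"
proof -
  have eq: "iter_df (dist_fun M X) 1 x = iter_df (dist_fun M Y) 1 x" if "c < x" for x
    using that dist_fun_eq_1[OF M X] dist_fun_eq_1[OF M Y] \<open>b \<le> c\<close> by simp
  note F = mono_from_dist_fun[OF M X] and G = mono_from_dist_fun[OF M Y]
  from iter_df_increment_le[OF F G _ \<open>c \<le> d\<close>, of 1]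
    iter_df_increment_le[OF G F _ \<open>c \<le> d\<close>, of 1] eq
  show ?thesis
    by (simp add: numeral_2_eq_2 del: iter_df.simps)
qed

lemma sd_on_shrink:
  assumes M: "prob_space M" and X: "X \<in> rvs M a b" and Y: "Y \<in> rvs M a b"
    and "a \<le> c" and "b \<le> c" and "c \<le> d" and "1 \<le> n" and "n \<le> 3"
    and sd: "sd_on M n a d X Y"
  shows "sd_on M n a c X Y"
proof -
  let ?F = "dist_fun M X" and ?G = "dist_fun M Y"
  have "iter_df ?F k c \<le> iter_df ?G k c" if k: "k \<in> {1..n}" for k
  proof -
    \<comment> \<open>The order \<open>n\<close> is covered by the pointwise condition at \<open>c\<close>, so only the orders 1 and 2
        remain.\<close>
    from k \<open>n \<le> 3\<close> consider "k = n" | "k = 1" | "k = 2" "2 \<le> n" by force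
    then show ?thesis
    proof cases
      case 1
      then show ?thesis using sd \<open>a \<le> c\<close> \<open>c \<le> d\<close> by (auto simp: sd_on_def)
    next
      case 2
      then show ?thesis
        using dist_fun_eq_1[OF M X] dist_fun_eq_1[OF M Y] \<open>b \<le> c\<close> by simp
    next
      case 3
      then have "iter_df ?F 2 d \<le> iter_df ?G 2 d"
        using sd by (auto simp: sd_on_def simp del: iter_df.simps)
      then show ?thesis
        using iter_df_2_diff_constant[OF M X Y \<open>b \<le> c\<close> \<open>c \<le> d\<close>] 3 by simp
    qed
  qed
  then show ?thesis
    using sd \<open>c \<le> d\<close> by (auto simp: sd_on_def)
qed

section \<open>Two-point distributions\<close>

text \<open>
  The truncated power \<open>(\<eta> - x)\<^sub>+\<^sup>k / k!\<close>, right-continuous also for \<open>k = 0\<close>: then it is the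
  distribution function of the point mass at \<open>x\<close>.
\<close>

definition trunc_pow :: "nat \<Rightarrow> real \<Rightarrow> real \<Rightarrow> real" where
  "trunc_pow k x \<eta> = (if x \<le> \<eta> then (\<eta> - x) ^ k / fact k else 0)"

lemma mono_from_trunc_pow: "mono_from x (trunc_pow k x)"
  by (auto simp: mono_from_def trunc_pow_def intro!: monoI divide_right_mono power_mono)

lemma integral_trunc_pow:
  "(LBINT \<xi>:{..\<eta>}. trunc_pow k x \<xi>) = trunc_pow (Suc k) x \<eta>"
proof (cases "x \<le> \<eta>")
  case True
  have "(LBINT \<xi>:{..\<eta>}. trunc_pow k x \<xi>)
      = (LBINT \<xi>. ((\<xi> - x) ^ k / fact k) * indicator {x..\<eta>} \<xi>)"
    unfolding set_lebesgue_integral_def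
    by (intro Bochner_Integration.integral_cong) (auto simp: trunc_pow_def indicator_def)
  also have "\<dots> = (\<eta> - x) ^ Suc k / fact (Suc k) - (x - x) ^ Suc k / fact (Suc k)"
  proof (rule integral_FTC_Icc_real[OF True])
    fix y
    have "((\<lambda>y. (y - x) ^ Suc k / fact (Suc k)) has_real_derivative
        (real (Suc k) * (y - x) ^ k) / fact (Suc k)) (at y)"
      by (auto intro!: derivative_eq_intros simp del: power_Suc of_nat_Suc fact_Suc)
    moreover have "(real (Suc k) * (y - x) ^ k) / fact (Suc k) = (y - x) ^ k / fact k"
      by (simp only: fact_Suc of_nat_mult) (simp add: divide_simps del: of_nat_Suc)
    ultimately show "((\<lambda>y. (y - x) ^ Suc k / fact (Suc k)) has_real_derivative
        (y - x) ^ k / fact k) (at y)"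
      by simp
  qed (auto intro!: continuous_intros)
  finally show ?thesis
    using True by (simp add: trunc_pow_def)
next
  case False
  then have "(\<lambda>\<xi>. indicator {..\<eta>} \<xi> *\<^sub>R trunc_pow k x \<xi>) = (\<lambda>_. 0)"
    by (auto simp: trunc_pow_def indicator_def)
  with False show ?thesis
    by (simp add: set_lebesgue_integral_def trunc_pow_def)
qed

lemma iter_df_two_point:
  "iter_df (\<lambda>\<eta>. u * trunc_pow 0 x \<eta> + v * trunc_pow 0 y \<eta>) (Suc k)
     = (\<lambda>\<eta>. u * trunc_pow k x \<eta> + v * trunc_pow k y \<eta>)"
proof (induction k)
  case (Suc k)
  have "set_integrable lborel {..\<eta>} (trunc_pow k z)" for \<eta> z
    by (rule mono_from_set_integrable[OF mono_from_trunc_pow]) auto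
  then show ?case
    unfolding iter_df.simps Suc
    by (simp add: set_integral_add integral_trunc_pow)
qed simp

lemma ex_two_point_rv:
  assumes "rich_prob_space M" and "a < b" and "x \<in> {a..b}" and "y \<in> {a..b}"
    and "0 \<le> u" and "0 \<le> v" and "u + v = 1"
  obtains X where "X \<in> rvs M a b"
    and "dist_fun M X = (\<lambda>\<eta>. u * trunc_pow 0 x \<eta> + v * trunc_pow 0 y \<eta>)"
proof -
  interpret rich_prob_space M by fact
  define f where "f = (\<lambda>s. if s then x else y)"
  define N where "N = distr (measure_pmf (bernoulli_pmf u)) borel f"
  have u: "0 \<le> u" "u \<le> 1" and v: "v = 1 - u" using assms by auto
  have N: "measure N S = u * indicator S x + v * indicator S y" if "S \<in> sets borel" for S
  proof -
    have "measure N S = measure (measure_pmf (bernoulli_pmf u)) (f -` S)"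
      using that by (simp add: N_def measure_distr)
    also have "\<dots> = measure_pmf.expectation (bernoulli_pmf u) (indicator (f -` S))"
      by simp
    also have "indicator (f -` S) = (\<lambda>s. indicat_real S (f s))"
      by (auto simp: indicator_def)
    also have "measure_pmf.expectation (bernoulli_pmf u) \<dots> = u * indicator S x + v * indicator S y"
      using u by (subst integral_bernoulli_pmf) (auto simp: f_def v)
    finally show ?thesis .
  qed
  have "real_distribution N"
    unfolding N_def by (rule prob_space.real_distribution_distr) (auto intro: measure_pmf.prob_space_axioms)
  moreover have "measure N {a..b} = 1"
    using assms by (simp add: N)
  ultimately obtain X where X: "X \<in> rvs M a b" "distr M borel X = N"
    using rich \<open>a < b\<close> by blast
  have "dist_fun M X = (\<lambda>\<eta>. u * trunc_pow 0 x \<eta> + v * trunc_pow 0 y \<eta>)"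
    by (auto simp: dist_fun_def X cdf_def N trunc_pow_def indicator_def)
  with X show ?thesis using that by blast
qed

section \<open>Failure of the converse from order four on\<close>

text \<open>
  The third difference of the truncated cube with step \<open>h\<close> has the knots \<open>-h, 0, h, 2h\<close>; it
  increases from \<open>h\<^sup>3\<close> at \<open>t = 0\<close> to the constant \<open>6h\<^sup>3\<close> beyond the last knot.
\<close>

lemma third_difference_trunc_pow_bound:
  fixes h t :: real
  assumes "0 < h" "0 \<le> t"
  shows "h ^ 3 \<le> (t + h) ^ 3 - 3 * t ^ 3 + 3 * (max 0 (t - h)) ^ 3 - (max 0 (t - 2 * h)) ^ 3"
proof -
  consider "t \<le> h" | "h \<le> t" "t \<le> 2 * h" | "2 * h \<le> t" by linarith
  then show ?thesis
  proof cases
    case 1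
    have "(t + h) ^ 3 - 3 * t ^ 3 - h ^ 3 = 3 * t * h\<^sup>2 + t\<^sup>2 * (h + 2 * (h - t))"
      by (simp add: power2_eq_square power3_eq_cube algebra_simps)
    moreover have "0 \<le> 3 * t * h\<^sup>2 + t\<^sup>2 * (h + 2 * (h - t))"
      using assms 1 by (intro add_nonneg_nonneg mult_nonneg_nonneg) auto
    ultimately have "h ^ 3 \<le> (t + h) ^ 3 - 3 * t ^ 3" by linarith
    then show ?thesis using assms 1 by simp
  next
    case 2
    have "(t + h) ^ 3 - 3 * t ^ 3 + 3 * (t - h) ^ 3 = 6 * h ^ 3 - (2 * h - t) ^ 3"
      by (simp add: power2_eq_square power3_eq_cube algebra_simps)
    moreover have "(2 * h - t) ^ 3 \<le> h ^ 3"
      using 2 by (intro power_mono) auto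
    moreover have "0 \<le> h ^ 3" using assms by simp
    ultimately have "h ^ 3 \<le> (t + h) ^ 3 - 3 * t ^ 3 + 3 * (t - h) ^ 3" by linarith
    then show ?thesis using 2 by simp
  next
    case 3
    have "(t + h) ^ 3 - 3 * t ^ 3 + 3 * (t - h) ^ 3 - (t - 2 * h) ^ 3 = 6 * h ^ 3"
      by (simp add: power2_eq_square power3_eq_cube algebra_simps)
    moreover have "0 \<le> h ^ 3" using assms by simp
    ultimately show ?thesis using assms 3 by simp
  qed
qed

lemma trunc_pow_3: "trunc_pow 3 x \<eta> = (max 0 (\<eta> - x)) ^ 3 / 6"
  by (auto simp: trunc_pow_def fact_numeral)

lemma ex_sd_on_not_shrink:
  assumes M: "rich_prob_space M"
    and "a < b" and "b \<le> c" and "c < d" and "4 \<le> n"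
  shows "\<exists>X\<in>rvs M a b. \<exists>Y\<in>rvs M a b. sd_on M n a d X Y \<and> \<not> sd_on M n a c X Y"
proof -
  interpret rich_prob_space M by fact
  \<comment> \<open>\<open>b + r\<close> is the midpoint of \<open>[c, d]\<close>, where \<open>D\<^sub>3\<close> is to vanish. The weights \<open>A, -B, C\<close> at
      \<open>a + h, a + 2h, b\<close> form the perturbation: up to the factor \<open>\<kappa>\<close>, they are determined by
      total mass zero and the required zero of \<open>D\<^sub>3\<close>. The factor \<open>\<kappa>\<close> is chosen to make
      \<open>B (d - a)\<^sup>3 = h\<^sup>3\<close>, and \<open>T\<close> normalises the total mass.\<close>
  define h where "h = (b - a) / 3"
  define r where "r = (c + d) / 2 - b"
  define \<kappa> where "\<kappa> = h ^ 3 / (4 * (r + h) * (d - a) ^ 3)"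
  define A where "A = \<kappa> * (2 * r + h)"
  define B where "B = \<kappa> * (4 * (r + h))"
  define C where "C = \<kappa> * (2 * r + 3 * h)"
  define T where "T = 4 + B"
  have h: "0 < h" and b: "b = a + 3 * h" using \<open>a < b\<close> by (simp_all add: h_def field_simps)
  have r: "0 < r" using assms by (simp add: r_def)
  have \<kappa>: "0 < \<kappa>" using h r assms by (simp add: \<kappa>_def)
  have pos: "0 < A" "0 < B" "0 < C" "0 < T" and BAC: "A + C = B"
    using h r \<kappa> by (auto simp: A_def B_def C_def T_def add_pos_pos algebra_simps)
  have B_le: "B * (d - a) ^ 3 = h ^ 3"
    using h r assms by (simp add: B_def \<kappa>_def)

  have "(3 + A) / T + (1 + C) / T = (4 + (A + C)) / T" "1 / T + (3 + B) / T = (4 + B) / T"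
    by (simp_all add: add_divide_distrib)
  then have weights: "(3 + A) / T + (1 + C) / T = 1" "1 / T + (3 + B) / T = 1"
    using pos by (simp_all add: BAC T_def)
  obtain X where X: "X \<in> rvs M a b"
    and FX: "dist_fun M X = (\<lambda>\<eta>. (3 + A) / T * trunc_pow 0 (a + h) \<eta>
                                + (1 + C) / T * trunc_pow 0 b \<eta>)"
    using M \<open>a < b\<close>
    by (rule ex_two_point_rv[of M a b "a + h" b "(3 + A) / T" "(1 + C) / T"])
       (use h b pos weights in auto)
  obtain Y where Y: "Y \<in> rvs M a b"
    and FY: "dist_fun M Y = (\<lambda>\<eta>. 1 / T * trunc_pow 0 a \<eta>
                                + (3 + B) / T * trunc_pow 0 (a + 2 * h) \<eta>)"
    using M \<open>a < b\<close>
    by (rule ex_two_point_rv[of M a b a "a + 2 * h" "1 / T" "(3 + B) / T"])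
       (use h b pos weights in auto)
  let ?F = "dist_fun M X" and ?G = "dist_fun M Y"
  \<comment> \<open>\<open>E k\<close> is the difference of the iterated integrals of order \<open>k + 1\<close>, multiplied by \<open>T\<close>.\<close>
  define E where "E k \<eta> = (3 + A) * trunc_pow k (a + h) \<eta> + (1 + C) * trunc_pow k b \<eta>
      - trunc_pow k a \<eta> - (3 + B) * trunc_pow k (a + 2 * h) \<eta>" for k \<eta>
  have le_iff: "iter_df ?F (Suc k) \<eta> \<le> iter_df ?G (Suc k) \<eta> \<longleftrightarrow> E k \<eta> \<le> 0" for k \<eta>
  proof -
    have "iter_df ?F (Suc k) \<eta> - iter_df ?G (Suc k) \<eta> = E k \<eta> / T"
      unfolding FX FY iter_df_two_point E_def
      by (simp add: diff_divide_distrib add_divide_distrib distrib_right)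
    moreover have "E k \<eta> / T \<le> 0 \<longleftrightarrow> E k \<eta> \<le> 0"
      using pos by (simp add: divide_le_0_iff)
    ultimately show ?thesis by linarith
  qed

  have E0: "E 0 \<eta> = 0" if "b \<le> \<eta>" for \<eta>
    using that h BAC by (simp add: E_def trunc_pow_def b)
  have E1: "E 1 \<eta> = - 2 * \<kappa> * h\<^sup>2" if "b \<le> \<eta>" for \<eta>
    using that h
    by (simp add: E_def trunc_pow_def b A_def B_def C_def)
       (simp add: power2_eq_square algebra_simps)
  have E2: "E 2 \<eta> = 2 * \<kappa> * h\<^sup>2 * (r - (\<eta> - b))" if "b \<le> \<eta>" for \<eta>
  proof -
    have "2 * E 2 \<eta> = (3 + A) * (\<eta> - (a + h))\<^sup>2 + (1 + C) * (\<eta> - b)\<^sup>2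
        - (\<eta> - a)\<^sup>2 - (3 + B) * (\<eta> - (a + 2 * h))\<^sup>2"
      using that h by (simp add: E_def trunc_pow_def b)
    also have "\<dots> = 2 * (2 * \<kappa> * h\<^sup>2 * (r - (\<eta> - b)))"
      by (simp add: b A_def B_def C_def power2_eq_square) (simp add: algebra_simps)
    finally show ?thesis by simp
  qed
  have E3: "E 3 \<eta> \<le> 0" if "\<eta> \<le> d" for \<eta>
  proof (cases "\<eta> \<le> a + h")
    case True
    then show ?thesis
      using h by (simp add: E_def trunc_pow_3 b)
  next
    case False
    define t where "t = \<eta> - (a + h)"
    have t: "0 \<le> t" "t \<le> d - a" using False that h by (auto simp: t_def)
    \<comment> \<open>The positive part of the perturbation is at most \<open>h\<^sup>3\<close>, which the third difference
        outweighs.\<close>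
    have "t ^ 3 \<le> (d - a) ^ 3" "(max 0 (t - 2 * h)) ^ 3 \<le> (d - a) ^ 3"
      using t h by (auto intro!: power_mono)
    then have "A * t ^ 3 + C * (max 0 (t - 2 * h)) ^ 3 \<le> A * (d - a) ^ 3 + C * (d - a) ^ 3"
      using pos by (intro add_mono mult_left_mono) auto
    also have "\<dots> = h ^ 3"
      using B_le BAC by (simp flip: distrib_right)
    also have "\<dots> \<le> (t + h) ^ 3 - 3 * t ^ 3 + 3 * (max 0 (t - h)) ^ 3 - (max 0 (t - 2 * h)) ^ 3"
      using h t by (intro third_difference_trunc_pow_bound)
    finally have "A * t ^ 3 + C * (max 0 (t - 2 * h)) ^ 3
      \<le> (t + h) ^ 3 - 3 * t ^ 3 + 3 * (max 0 (t - h)) ^ 3 - (max 0 (t - 2 * h)) ^ 3" .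
    moreover have "0 \<le> B * (max 0 (t - h)) ^ 3"
      using pos by simp
    moreover have "6 * E 3 \<eta> = (3 + A) * t ^ 3 + (1 + C) * (max 0 (t - 2 * h)) ^ 3
        - (t + h) ^ 3 - (3 + B) * (max 0 (t - h)) ^ 3"
    proof -
      have "max 0 (\<eta> - (a + h)) = t" "max 0 (\<eta> - a) = t + h"
        "max 0 (\<eta> - b) = max 0 (t - 2 * h)" "max 0 (\<eta> - (a + 2 * h)) = max 0 (t - h)"
        using t h by (auto simp: t_def b algebra_simps)
      then show ?thesis by (simp add: E_def trunc_pow_3)
    qed
    ultimately show ?thesis by (simp add: algebra_simps)
  qed

  have F: "mono_from a ?F" and G: "mono_from a ?G"
    using mono_from_dist_fun[OF prob_space_axioms] X Y by auto
  have high: "iter_df ?F k \<eta> \<le> iter_df ?G k \<eta>" if "4 \<le> k" "\<eta> \<le> d" for k \<eta>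
  proof (rule iter_df_mono_below[OF F G _ \<open>4 \<le> k\<close> _ \<open>\<eta> \<le> d\<close>])
    show "iter_df ?F 4 x \<le> iter_df ?G 4 x" if "x \<le> d" for x
      using le_iff[of 3 x] E3[OF that] by (simp del: iter_df.simps)
  qed simp
  have "iter_df ?F k d \<le> iter_df ?G k d" if "1 \<le> k" for k
  proof -
    have "b \<le> d" "r - (d - b) \<le> 0" using assms by (auto simp: r_def)
    then have "E 0 d \<le> 0" and "E 1 d \<le> 0" and "E 2 d \<le> 0"
      using \<kappa> h E0[of d] E1[of d] E2[of d] by (auto simp: mult_nonneg_nonpos)
    then have low: "iter_df ?F (Suc 0) d \<le> iter_df ?G (Suc 0) d"
      "iter_df ?F (Suc 1) d \<le> iter_df ?G (Suc 1) d"
      "iter_df ?F (Suc 2) d \<le> iter_df ?G (Suc 2) d"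
      by (simp_all only: le_iff)
    from \<open>1 \<le> k\<close> consider "k = Suc 0" | "k = Suc 1" | "k = Suc 2" | "4 \<le> k"
      by force
    then show ?thesis
      using low high[of k d] by cases (simp_all only: order_refl)
  qed
  then have "sd_on M n a d X Y"
    using high \<open>4 \<le> n\<close> by (auto simp: sd_on_def)
  moreover have "0 < E 2 c"
    using assms \<kappa> h by (simp add: E2 r_def)
  then have "\<not> iter_df ?F 3 c \<le> iter_df ?G 3 c"
    using le_iff[of 2 c] by (simp del: iter_df.simps)
  then have "\<not> sd_on M n a c X Y"
    using \<open>4 \<le> n\<close> unfolding sd_on_def by force
  ultimately show ?thesis
    using X Y by blast
qed

theorem theorem1:
  fixes M :: "'w measure" and a b c d :: real and n :: nat
  assumes "rich_prob_space M"
    and "a < b" and "b \<le> c" and "c < d"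
    and "1 \<le> n"
  shows "(\<forall>X\<in>rvs M a b. \<forall>Y\<in>rvs M a b. sd_on M n a c X Y \<longrightarrow> sd_on M n a d X Y) \<and>
         ((\<forall>X\<in>rvs M a b. \<forall>Y\<in>rvs M a b. sd_on M n a d X Y \<longrightarrow> sd_on M n a c X Y) \<longleftrightarrow> n \<le> 3)"
proof -
  interpret rich_prob_space M by fact
  note P = prob_space_axioms
  have "sd_on M n a d X Y" if "X \<in> rvs M a b" "Y \<in> rvs M a b" "sd_on M n a c X Y" for X Y
    using sd_on_extend[OF P that(1,2) _ _ _ that(3)] assms by simp
  moreover have "sd_on M n a c X Y"
    if "n \<le> 3" "X \<in> rvs M a b" "Y \<in> rvs M a b" "sd_on M n a d X Y" for X Y
    using sd_on_shrink[OF P that(2,3) _ _ _ _ that(1,4)] assms by simp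
  moreover have "n \<le> 3"
    if "\<forall>X\<in>rvs M a b. \<forall>Y\<in>rvs M a b. sd_on M n a d X Y \<longrightarrow> sd_on M n a c X Y"
  proof (rule ccontr)
    assume "\<not> n \<le> 3"
    then have "4 \<le> n" by simp
    from ex_sd_on_not_shrink[OF assms(1-4) this] that show False by blast
  qed
  ultimately show ?thesis by blast
qed

end
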